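(* Let $m\ge 2$ be an integer and let $u$ be a real function which is $m$ times continuously differentiable in a neighbourhood $D\subset\mathbb{R}$ of an isolated fixed point $x^*$ of $u$. Assume that $$u(x^* )=x^*,\qquad u'(x^* )=1,\qquad u^{(j)}(x^* )=0\ \text{ for } 2\le j\le m-1,\qquad u^{(m)}(x^* )\neq 0 .$$ Define, near $x^*$, $$v(x)=\begin{cases}\dfrac{u(x)-x\,u'(x)}{1-u'(x)}, & x\neq x^*,\\[2mm] x^*, & x=x^*,\end{cases}$$ and $$w(x)=\frac{v(x)-x\,v'(x)}{1-v'(x)} .$$ Then $w$ is an accelerator of $u$, that is, $w(x^* )=x^*$ and $w'(x^* )=0$.
   Context: An accelerator of an iteration function $u$ with fixed point $x^*$ is an iteration function $h$ with the same fixed point, $h(x^* )=x^*$, such that $h'(x^* )=0$. Functions are considered in a sufficiently small neighbourhood of $x^*$. *)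

theory Defs
  imports "HOL-Analysis.Analysis"
begin

text \<open>
  Continuity of the derivatives of order below \<open>m\<close> follows from their differentiability.
  Since \<^const>\<open>deriv\<close> is a two-sided derivative, this is intended for open \<open>D\<close>.
\<close>

definition times_cont_differentiable_on :: "nat \<Rightarrow> (real \<Rightarrow> real) \<Rightarrow> real set \<Rightarrow> bool" where
  "times_cont_differentiable_on m f D \<longleftrightarrow>
     (\<forall>j<m. \<forall>x\<in>D. (deriv ^^ j) f field_differentiable at x) \<and>
     continuous_on D ((deriv ^^ m) f)"

definition accelerator :: "real \<Rightarrow> (real \<Rightarrow> real) \<Rightarrow> (real \<Rightarrow> real) \<Rightarrow> bool" where
  "accelerator xs u h \<longleftrightarrow>
     u xs = xs \<and> h xs = xs \<and> (h has_real_derivative 0) (at xs)"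

end

theory Submission
  imports Defs
begin

text \<open>
  Put \<open>g x = u x - x\<close> and \<open>e = x - x\<^sup>*\<close>. By L'Hopital's rule \<open>g\<close>, \<open>g'\<close>, \<open>g''\<close> are asymptotic to
  \<open>A e\<^sup>m / m!\<close>, \<open>A e\<^bsup>m-1\<^esup> / (m-1)!\<close>, \<open>A e\<^bsup>m-2\<^esup> / (m-2)!\<close> with \<open>A = u\<^bsup>(m)\<^esup> x\<^sup>* \<noteq> 0\<close>. Since
  \<open>v = x - g / g'\<close> and \<open>v' = g g'' / g'\<^sup>2\<close>, both \<open>(v - x\<^sup>*) / e\<close> and \<open>v'\<close> tend to \<open>1 - 1/m \<noteq> 1\<close>,
  so \<open>(w - x\<^sup>*) / e = ((v - x\<^sup>*) / e - v') / (1 - v')\<close> tends to \<open>0\<close>.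
\<close>

text \<open>One application of L'Hopital's rule: continuity and \<open>f a = 0\<close> give the form
  0/0, and differentiating the power contributes the factor \<open>Suc n\<close>. Differentiability
  is asked only on a punctured neighbourhood of \<open>a\<close>.\<close>

lemma tendsto_divide_power_of_deriv:
  fixes f f' :: "real \<Rightarrow> real"
  assumes "f a = 0" and "isCont f a"
    and f': "\<forall>\<^sub>F x in at a. (f has_real_derivative f' x) (at x)"
    and lim: "((\<lambda>x. f' x / (x - a) ^ n) \<longlongrightarrow> c) (at a)"
  shows "((\<lambda>x. f x / (x - a) ^ Suc n) \<longlongrightarrow> c / real (Suc n)) (at a)"
proof (rule lhopital)
  show "(f \<longlongrightarrow> 0) (at a)"
    using assms(1,2) by (simp add: isCont_def)
  show "((\<lambda>x. (x - a) ^ Suc n) \<longlongrightarrow> 0) (at a)"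
    by (auto intro!: tendsto_eq_intros)
  have ne: "\<forall>\<^sub>F x in at a. x - a \<noteq> 0"
    by (simp add: eventually_at_filter)
  show "\<forall>\<^sub>F x in at a. (x - a) ^ Suc n \<noteq> 0"
    using ne by eventually_elim simp
  show "\<forall>\<^sub>F x in at a. real (Suc n) * (x - a) ^ n \<noteq> 0"
    using ne by eventually_elim simp
  show "\<forall>\<^sub>F x in at a. (f has_real_derivative f' x) (at x)"
    by (rule f')
  show "\<forall>\<^sub>F x in at a. ((\<lambda>x. (x - a) ^ Suc n) has_real_derivative real (Suc n) * (x - a) ^ n) (at x)"
    by (auto intro!: derivative_eq_intros always_eventually simp del: power_Suc)
  have "((\<lambda>x. (f' x / (x - a) ^ n) / real (Suc n)) \<longlongrightarrow> c / real (Suc n)) (at a)"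
    by (intro tendsto_divide lim tendsto_const) simp
  then show "((\<lambda>x. f' x / (real (Suc n) * (x - a) ^ n)) \<longlongrightarrow> c / real (Suc n)) (at a)"
    by (simp add: mult.commute)
qed

text \<open>This plays the role of Taylor's formula with only the leading term. The induction
  descends from \<open>k = m\<close>, where the claim is continuity of the top derivative; each
  lowering of \<open>k\<close> is one L'Hopital step, whose factor extends the factorial.\<close>

lemma tendsto_higher_deriv_divide_power:
  fixes f :: "real \<Rightarrow> real"
  assumes "k \<le> m"
    and cont: "isCont ((deriv ^^ m) f) a"
    and diff: "\<And>j. j < m \<Longrightarrow> \<forall>\<^sub>F x in nhds a. (deriv ^^ j) f field_differentiable at x"
    and zero: "\<And>j. k \<le> j \<Longrightarrow> j < m \<Longrightarrow> (deriv ^^ j) f a = 0"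
  shows "((\<lambda>x. (deriv ^^ k) f x / (x - a) ^ (m - k)) \<longlongrightarrow> (deriv ^^ m) f a / fact (m - k)) (at a)"
  using \<open>k \<le> m\<close> zero
proof (induction k rule: inc_induct)
  case base
  show ?case
    using cont by (simp add: isCont_def)
next
  case (step j)
  have "((\<lambda>x. (deriv ^^ j) f x / (x - a) ^ Suc (m - Suc j))
      \<longlongrightarrow> (deriv ^^ m) f a / fact (m - Suc j) / real (Suc (m - Suc j))) (at a)"
  proof (rule tendsto_divide_power_of_deriv)
    show "(deriv ^^ j) f a = 0"
      using step by simp
    show "isCont ((deriv ^^ j) f) a"
      using diff[OF \<open>j < m\<close>]
      by (intro field_differentiable_imp_continuous_at) (rule eventually_nhds_x_imp_x)
    have "\<forall>\<^sub>F x in nhds a. ((deriv ^^ j) f has_real_derivative (deriv ^^ Suc j) f x) (at x)"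
      using diff[OF \<open>j < m\<close>] by eventually_elim (simp add: DERIV_deriv_iff_field_differentiable)
    then show "\<forall>\<^sub>F x in at a. ((deriv ^^ j) f has_real_derivative (deriv ^^ Suc j) f x) (at x)"
      by (simp add: eventually_at_filter eventually_mono)
    show "((\<lambda>x. (deriv ^^ Suc j) f x / (x - a) ^ (m - Suc j))
        \<longlongrightarrow> (deriv ^^ m) f a / fact (m - Suc j)) (at a)"
      by (rule step.IH) (use step.prems in auto)
  qed
  moreover have "m - j = Suc (m - Suc j)"
    using step by simp
  ultimately show ?case
    by (simp add: mult.commute)
qed

theorem proposition5:
  fixes u v w :: "real \<Rightarrow> real" and D :: "real set" and xs :: real and m :: nat
  assumes "m \<ge> 2"
    and "open D" and "xs \<in> D"
    and "times_cont_differentiable_on m u D"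
    and "xs isolated_in {x \<in> D. u x = x}"
    and "u xs = xs"
    and "deriv u xs = 1"
    and "\<forall>j\<in>{2..m-1}. (deriv ^^ j) u xs = 0"
    and "(deriv ^^ m) u xs \<noteq> 0"
    and "\<forall>\<^sub>F x in nhds xs.
           v x = (if x = xs then xs else (u x - x * deriv u x) / (1 - deriv u x))"
    and "\<forall>\<^sub>F x in nhds xs. w x = (v x - x * deriv v x) / (1 - deriv v x)"
  shows "(\<forall>\<^sub>F x in at xs. 1 - deriv u x \<noteq> 0) \<and>
         (\<forall>\<^sub>F x in nhds xs. v field_differentiable at x \<and> 1 - deriv v x \<noteq> 0) \<and>
         accelerator xs u w"
proof -
  note v_eq = assms(10) and w_eq = assms(11)
  \<comment> \<open>With \<open>n = m - 2\<close>, the orders of vanishing of \<open>g\<close>,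
    \<open>g'\<close>, \<open>g''\<close> are \<open>m\<close>, \<open>Suc n\<close> and
    \<open>n\<close>, free of truncated subtraction.\<close>
  obtain n where m: "m = Suc (Suc n)"
    using \<open>m \<ge> 2\<close> by (metis add_2_eq_Suc le_Suc_ex)
  define A where "A = (deriv ^^ m) u xs"
  have "A \<noteq> 0"
    using assms(9) by (simp add: A_def)
  have ne: "\<forall>\<^sub>F x in at xs. x \<noteq> xs"
    by (simp add: eventually_at_filter)
  have diff: "\<forall>\<^sub>F x in nhds xs. (deriv ^^ j) u field_differentiable at x" if "j < m" for j
    using eventually_nhds_in_open[OF assms(2,3)] that assms(4)
    by (auto simp: times_cont_differentiable_on_def elim!: eventually_mono)
  have u': "\<forall>\<^sub>F x in nhds xs. (u has_real_derivative deriv u x) (at x)"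
    using diff[of 0] by (simp add: m DERIV_deriv_iff_field_differentiable)
  have u'': "\<forall>\<^sub>F x in nhds xs. (deriv u has_real_derivative deriv (deriv u) x) (at x)"
    using diff[of 1] by (simp add: m DERIV_deriv_iff_field_differentiable)
  have lim2: "((\<lambda>x. deriv (deriv u) x / (x - xs) ^ n) \<longlongrightarrow> A / fact n) (at xs)"
  proof -
    have "isCont ((deriv ^^ m) u) xs"
      using assms(2-4) by (simp add: times_cont_differentiable_on_def continuous_on_eq_continuous_at)
    from tendsto_higher_deriv_divide_power[OF \<open>m \<ge> 2\<close> this diff] assms(8)
    show ?thesis
      by (simp add: m A_def numeral_2_eq_2)
  qed
  \<comment> \<open>The descent for \<open>u\<close> itself stops at order 2, since
    \<open>deriv u xs = 1\<close> is not zero. The last two L'Hopital steps are therefore made for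
    \<open>deriv u x - 1\<close> and \<open>u x - x\<close>, which do vanish at
    \<open>xs\<close>.\<close>
  have lim1: "((\<lambda>x. (deriv u x - 1) / (x - xs) ^ Suc n) \<longlongrightarrow> A / fact (Suc n)) (at xs)"
  proof -
    have "((\<lambda>x. (deriv u x - 1) / (x - xs) ^ Suc n) \<longlongrightarrow> A / fact n / real (Suc n)) (at xs)"
    proof (rule tendsto_divide_power_of_deriv[OF _ _ _ lim2])
      show "isCont (\<lambda>x. deriv u x - 1) xs"
        using DERIV_isCont[OF eventually_nhds_x_imp_x[OF u'']] by (intro continuous_intros) auto
      show "\<forall>\<^sub>F x in at xs. ((\<lambda>x. deriv u x - 1) has_real_derivative deriv (deriv u) x) (at x)"
        unfolding eventually_at_filter using u''
        by eventually_elim (auto intro!: derivative_eq_intros)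
    qed (simp add: assms)
    then show ?thesis
      by (simp add: mult.commute)
  qed
  have lim0: "((\<lambda>x. (u x - x) / (x - xs) ^ m) \<longlongrightarrow> A / fact m) (at xs)"
  proof -
    have "((\<lambda>x. (u x - x) / (x - xs) ^ Suc (Suc n)) \<longlongrightarrow> A / fact (Suc n) / real (Suc (Suc n))) (at xs)"
    proof (rule tendsto_divide_power_of_deriv[OF _ _ _ lim1])
      show "isCont (\<lambda>x. u x - x) xs"
        using DERIV_isCont[OF eventually_nhds_x_imp_x[OF u']] by (intro continuous_intros) auto
      show "\<forall>\<^sub>F x in at xs. ((\<lambda>x. u x - x) has_real_derivative deriv u x - 1) (at x)"
        unfolding eventually_at_filter using u'
        by eventually_elim (auto intro!: derivative_eq_intros)
    qed (simp add: assms)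
    then show ?thesis
      by (simp add: m mult.commute mult.left_commute)
  qed
  have u'_ne: "\<forall>\<^sub>F x in at xs. 1 - deriv u x \<noteq> 0"
  proof -
    have "\<forall>\<^sub>F x in at xs. (deriv u x - 1) / (x - xs) ^ Suc n \<noteq> 0"
      by (rule tendsto_imp_eventually_ne[OF lim1]) (use \<open>A \<noteq> 0\<close> in simp)
    then show ?thesis
      by eventually_elim auto
  qed

  \<comment> \<open>Away from \<open>xs\<close>, \<open>v\<close> is the Newton map of
    \<open>u x - x\<close>, and \<open>q\<close> is the linear convergence factor of Newton's method
    at a zero of multiplicity \<open>m\<close>.\<close>
  define q where "q = 1 - 1 / real m"
  have v_slope: "((\<lambda>x. (v x - xs) / (x - xs)) \<longlongrightarrow> q) (at xs)"
  proof -
    have "((\<lambda>x. 1 - ((u x - x) / (x - xs) ^ m) / ((deriv u x - 1) / (x - xs) ^ Suc n))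
        \<longlongrightarrow> 1 - (A / fact m) / (A / fact (Suc n))) (at xs)"
      by (intro tendsto_intros lim0 lim1) (use \<open>A \<noteq> 0\<close> in simp)
    also have "1 - (A / fact m) / (A / fact (Suc n)) = q"
      using \<open>A \<noteq> 0\<close> by (simp add: m q_def del: of_nat_Suc)
    finally show ?thesis
    proof (rule Lim_transform_eventually)
      have "\<forall>\<^sub>F x in at xs. v x = (if x = xs then xs else (u x - x * deriv u x) / (1 - deriv u x))"
        using v_eq by (simp add: eventually_at_filter eventually_mono)
      then show "\<forall>\<^sub>F x in at xs. 1 - ((u x - x) / (x - xs) ^ m) / ((deriv u x - 1) / (x - xs) ^ Suc n)
          = (v x - xs) / (x - xs)"
        using ne u'_ne
      proof eventually_elim
        case (elim x)
        define e d where "e = x - xs" and "d = deriv u x - 1"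
        have "e \<noteq> 0" "d \<noteq> 0" and du: "deriv u x = d + 1"
          using elim by (auto simp: e_def d_def)
        have "v x = x - (u x - x) / d"
          using elim \<open>d \<noteq> 0\<close> unfolding du by (simp add: field_simps)
        then have "v x - xs = e - (u x - x) / d"
          by (simp add: e_def)
        then have "(v x - xs) / e = 1 - (u x - x) / (d * e)"
          using \<open>e \<noteq> 0\<close> by (simp add: diff_divide_distrib)
        then show ?case
          using \<open>e \<noteq> 0\<close> \<open>d \<noteq> 0\<close> unfolding e_def[symmetric] d_def[symmetric] by (simp add: m)
      qed
    qed
  qed
  have v_xs: "v xs = xs"
    using eventually_nhds_x_imp_x[OF v_eq] by simp
  \<comment> \<open>The quotient formula for the derivative of \<open>v\<close> is valid only off
    \<open>xs\<close>; at \<open>xs\<close> the derivative comes from the difference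
    quotient.\<close>
  have v'_xs: "(v has_real_derivative q) (at xs)"
    using v_slope by (simp add: has_field_derivative_iff v_xs)
  have v'_at: "\<forall>\<^sub>F x in at xs. (v has_real_derivative
      ((u x - x) * deriv (deriv u) x / (deriv u x - 1)\<^sup>2)) (at x)"
  proof -
    \<comment> \<open>Differentiating \<open>v\<close> at \<open>x\<close> requires its defining
      equation on a whole neighbourhood of \<open>x\<close>, not just at \<open>x\<close>.\<close>
    have "\<forall>\<^sub>F x in at xs. \<forall>\<^sub>F y in nhds x.
        v y = (if y = xs then xs else (u y - y * deriv u y) / (1 - deriv u y))"
      using iffD2[OF eventually_eventually v_eq] unfolding eventually_at_filter
      by (rule eventually_mono) simp
    moreover have "\<forall>\<^sub>F x in at xs. (u has_real_derivative deriv u x) (at x)"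
      using u' by (simp add: eventually_at_filter eventually_mono)
    moreover have "\<forall>\<^sub>F x in at xs. (deriv u has_real_derivative deriv (deriv u) x) (at x)"
      using u'' by (simp add: eventually_at_filter eventually_mono)
    ultimately show ?thesis
      using ne u'_ne
    proof eventually_elim
      case (elim x)
      have "\<forall>\<^sub>F y in nhds x. y \<noteq> xs"
        using elim(4) by (rule t1_space_nhds)
      with elim(1) have eq: "\<forall>\<^sub>F y in nhds x. v y = (u y - y * deriv u y) / (1 - deriv u y)"
        by eventually_elim simp
      have "((\<lambda>y. (u y - y * deriv u y) / (1 - deriv u y)) has_real_derivative
          ((deriv u x - (deriv u x + x * deriv (deriv u) x)) * (1 - deriv u x)
            - (u x - x * deriv u x) * (- deriv (deriv u) x)) / ((1 - deriv u x) * (1 - deriv u x))) (at x)"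
        using elim(2,3,5) by (auto intro!: derivative_eq_intros)
      also have "((deriv u x - (deriv u x + x * deriv (deriv u) x)) * (1 - deriv u x)
            - (u x - x * deriv u x) * (- deriv (deriv u) x)) / ((1 - deriv u x) * (1 - deriv u x))
          = (u x - x) * deriv (deriv u) x / (deriv u x - 1)\<^sup>2"
        by (rule arg_cong2[where f = "(/)"]) (simp_all add: algebra_simps power2_eq_square)
      finally show ?case
        using DERIV_cong_ev[OF refl eq refl] by blast
    qed
  qed
  have v'_lim: "(deriv v \<longlongrightarrow> q) (at xs)"
  proof -
    have "((\<lambda>x. ((u x - x) / (x - xs) ^ m) * (deriv (deriv u) x / (x - xs) ^ n)
          / ((deriv u x - 1) / (x - xs) ^ Suc n)\<^sup>2)
        \<longlongrightarrow> (A / fact m) * (A / fact n) / (A / fact (Suc n))\<^sup>2) (at xs)"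
      by (intro tendsto_intros lim0 lim1 lim2) (use \<open>A \<noteq> 0\<close> in simp)
    \<comment> \<open>The powers of \<open>x - xs\<close> cancel because
      \<open>m + n = 2 * Suc n\<close>; the factorials leave \<open>(n + 1) / (n + 2)\<close>, which
      is \<open>q\<close>.\<close>
    also have "(A / fact m) * (A / fact n) / (A / fact (Suc n))\<^sup>2 = q"
      using \<open>A \<noteq> 0\<close> by (simp add: m q_def power2_eq_square divide_simps)
    finally show ?thesis
    proof (rule Lim_transform_eventually)
      show "\<forall>\<^sub>F x in at xs. ((u x - x) / (x - xs) ^ m) * (deriv (deriv u) x / (x - xs) ^ n)
          / ((deriv u x - 1) / (x - xs) ^ Suc n)\<^sup>2 = deriv v x"
        using v'_at ne u'_ne
      proof eventually_elim
        case (elim x)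
        define e d where "e = x - xs" and "d = deriv u x - 1"
        have "e \<noteq> 0" "d \<noteq> 0"
          using elim by (auto simp: e_def d_def)
        then show ?case
          unfolding DERIV_imp_deriv[OF elim(1)] e_def[symmetric] d_def[symmetric]
          by (simp add: m power2_eq_square divide_simps)
      qed
    qed
  qed
  \<comment> \<open>This keeps the denominator of \<open>w\<close> away from zero, both near
    \<open>xs\<close> and at \<open>xs\<close> itself, where \<open>w\<close> is given by the same
    quotient.\<close>
  have "q \<noteq> 1"
    using \<open>m \<ge> 2\<close> by (simp add: q_def)
  have v'_ne: "\<forall>\<^sub>F x in at xs. deriv v x \<noteq> 1"
    by (rule tendsto_imp_eventually_ne[OF v'_lim \<open>q \<noteq> 1\<close>])
  have deriv_v_xs: "deriv v xs = q"
    by (rule DERIV_imp_deriv[OF v'_xs])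
  have "\<forall>\<^sub>F x in at xs. v field_differentiable at x \<and> 1 - deriv v x \<noteq> 0"
    using v'_at v'_ne by eventually_elim (auto simp: field_differentiable_def)
  moreover have "v field_differentiable at xs \<and> 1 - deriv v xs \<noteq> 0"
    using v'_xs \<open>q \<noteq> 1\<close> by (auto simp: field_differentiable_def deriv_v_xs)
  ultimately have v_good: "\<forall>\<^sub>F x in nhds xs. v field_differentiable at x \<and> 1 - deriv v x \<noteq> 0"
    by (simp add: eventually_nhds_conv_at)

  have "w xs = xs * (1 - q) / (1 - q)"
    using eventually_nhds_x_imp_x[OF w_eq] by (simp add: v_xs deriv_v_xs right_diff_distrib)
  then have w_xs: "w xs = xs"
    using \<open>q \<noteq> 1\<close> by simp
  \<comment> \<open>Subtracting \<open>xs\<close> from \<open>w x\<close> turns the numerator into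
    \<open>(v x - xs) - (x - xs) * deriv v x\<close>. Dividing by \<open>x - xs\<close> leaves the
    slope of \<open>v\<close> minus its derivative, two quantities with the same limit
    \<open>q\<close>.\<close>
  have "((\<lambda>x. ((v x - xs) / (x - xs) - deriv v x) / (1 - deriv v x)) \<longlongrightarrow> (q - q) / (1 - q)) (at xs)"
    by (intro tendsto_intros v_slope v'_lim) (use \<open>q \<noteq> 1\<close> in simp)
  then have "((\<lambda>x. (w x - xs) / (x - xs)) \<longlongrightarrow> (q - q) / (1 - q)) (at xs)"
  proof (rule Lim_transform_eventually)
    have "\<forall>\<^sub>F x in at xs. w x = (v x - x * deriv v x) / (1 - deriv v x)"
      using w_eq by (simp add: eventually_at_filter eventually_mono)
    then show "\<forall>\<^sub>F x in at xs. ((v x - xs) / (x - xs) - deriv v x) / (1 - deriv v x)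
        = (w x - xs) / (x - xs)"
      using ne v'_ne
    proof eventually_elim
      case (elim x)
      then show ?case
        by (simp add: divide_simps) (simp add: algebra_simps)
    qed
  qed
  then have "(w has_real_derivative 0) (at xs)"
    by (simp add: has_field_derivative_iff w_xs)
  with u'_ne v_good w_xs \<open>u xs = xs\<close> show ?thesis
    by (simp add: accelerator_def)
qed

end
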